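(* Let $a$ be a real number with $-1/3<a<0$, and for each prime power $q$ let $p=q^{a}$ and let $Q_p\subseteq\mathbb F_q^2$ be a $p$-random set. Let $f:\mathbb R\to\mathbb R$ be any function with $\lim_{q\to\infty}f(q)=\infty$. Then \[ \lim_{q\to\infty}\mathbb P\big[a(Q_p)\ge qpf(q)\big]=0, \] where the limit is over prime powers $q$.
   Context: $\mathbb F_q$ is the finite field with $q$ elements. An arc in $\mathbb F_q^2$ is a set of points no three of which lie on a common line. For $P\subseteq\mathbb F_q^2$, $a(P)$ denotes the maximum size of an arc $P'\subseteq P$. A $p$-random set $Q_p\subseteq\mathbb F_q^2$ is a random subset in which each point $x\in\mathbb F_q^2$ is included independently with probability $p$. *)

theory Defs
  imports "HOL-Probability.Probability" "HOL-Algebra.Ring" "HOL-Number_Theory.Prime_Powers"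
begin

definition plane :: "('a, 'm) ring_scheme \<Rightarrow> ('a \<times> 'a) set" where
  "plane F = carrier F \<times> carrier F"

definition line_of :: "('a, 'm) ring_scheme \<Rightarrow> 'a \<Rightarrow> 'a \<Rightarrow> 'a \<Rightarrow> ('a \<times> 'a) set" where
  "line_of F u v w = {(x, y) \<in> plane F. u \<otimes>\<^bsub>F\<^esub> x \<oplus>\<^bsub>F\<^esub> v \<otimes>\<^bsub>F\<^esub> y = w}"

definition lines :: "('a, 'm) ring_scheme \<Rightarrow> ('a \<times> 'a) set set" where
  "lines F = {line_of F u v w | u v w. u \<in> carrier F \<and> v \<in> carrier F \<and> w \<in> carrier F
                \<and> \<not> (u = \<zero>\<^bsub>F\<^esub> \<and> v = \<zero>\<^bsub>F\<^esub>)}"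

definition arc_in :: "('a, 'm) ring_scheme \<Rightarrow> ('a \<times> 'a) set \<Rightarrow> bool" where
  "arc_in F S \<longleftrightarrow> S \<subseteq> plane F \<and>
     (\<forall>x\<in>S. \<forall>y\<in>S. \<forall>z\<in>S. x \<noteq> y \<and> y \<noteq> z \<and> x \<noteq> z \<longrightarrow>
        \<not> (\<exists>l\<in>lines F. x \<in> l \<and> y \<in> l \<and> z \<in> l))"

definition max_arc :: "('a, 'm) ring_scheme \<Rightarrow> ('a \<times> 'a) set \<Rightarrow> nat" where
  "max_arc F P = Max {card S | S. S \<subseteq> P \<and> arc_in F S}"

(* Distribution of the random subset of the finite set A that contains each element
   of A independently with probability p; only meaningful for p in [0,1]. *)
definition random_subset :: "'b set \<Rightarrow> real \<Rightarrow> 'b set pmf" where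
  "random_subset A p = map_pmf (\<lambda>b. {x \<in> A. b x}) (Pi_pmf A False (\<lambda>_. bernoulli_pmf p))"

end

theory Submission
  imports Defs "HOL-Algebra.Multiplicative_Group" "HOL-Real_Asymp.Real_Asymp"
begin

text \<open>
  Fix a set \<open>B\<close> of about \<open>sqrt q\<close> points of an arc \<open>A\<close> and join two points of the plane when
  some point of \<open>B\<close> lies on the line through them; then \<open>A - B\<close> is independent in this graph.
  Counting the pairs of a point set \<open>U\<close> collinear with a given point of \<open>B\<close> by Cauchy-Schwarz over
  the \<open>q + 1\<close> directions, and using that every line meets \<open>B\<close> in at most two points, any \<open>U\<close> with
  more than \<open>2 (q + 1)\<close> points has a vertex adjacent to a fraction \<open>card B / (4 (q + 1))\<close> of \<open>U\<close>.
  Branching repeatedly on such a vertex covers all independent sets by \<open>exp (O(sqrt q (ln q)^2))\<close>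
  containers of size at most \<open>4 q\<close>. Each container meets the random set in at least \<open>9 q p\<close> points
  with probability at most \<open>exp (- 2 q p)\<close>, and \<open>q p \<ge> q powr (2 / 3)\<close> dominates the logarithm of
  the number of pairs of a set \<open>B\<close> and a container.
\<close>

section \<open>Containers for independent sets\<close>

definition has_containers :: "nat \<Rightarrow> nat \<Rightarrow> 'b set set \<Rightarrow> bool" where
  "has_containers n m \<S> \<longleftrightarrow>
     (\<exists>\<C>. finite \<C> \<and> card \<C> \<le> n \<and> (\<forall>C\<in>\<C>. finite C \<and> card C \<le> m) \<and> (\<forall>S\<in>\<S>. \<exists>C\<in>\<C>. S \<subseteq> C))"

lemma has_containers_Pow:
  assumes "finite V" "card V \<le> m"
  shows "has_containers 1 m (Pow V)"
  unfolding has_containers_def by (rule exI[of _ "{V}"]) (use assms in auto)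

lemma has_containers_mono:
  assumes "has_containers n m \<S>" "n \<le> n'" "m \<le> m'" "\<S>' \<subseteq> \<S>"
  shows "has_containers n' m' \<S>'"
  using assms unfolding has_containers_def by (meson order_trans subsetD)

lemma has_containers_Un:
  assumes "has_containers n m \<S>" "has_containers n' m \<S>'"
  shows "has_containers (n + n') m (\<S> \<union> \<S>')"
proof -
  obtain \<C> where \<C>: "finite \<C>" "card \<C> \<le> n" "\<forall>C\<in>\<C>. finite C \<and> card C \<le> m" "\<forall>S\<in>\<S>. \<exists>C\<in>\<C>. S \<subseteq> C"
    using assms(1) unfolding has_containers_def by blast
  obtain \<C>' where \<C>': "finite \<C>'" "card \<C>' \<le> n'" "\<forall>C\<in>\<C>'. finite C \<and> card C \<le> m"
    "\<forall>S\<in>\<S>'. \<exists>C\<in>\<C>'. S \<subseteq> C"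
    using assms(2) unfolding has_containers_def by blast
  have "card (\<C> \<union> \<C>') \<le> n + n'"
    using card_Un_le[of \<C> \<C>'] \<C>(2) \<C>'(2) by linarith
  then show ?thesis
    unfolding has_containers_def using \<C> \<C>' by (intro exI[of _ "\<C> \<union> \<C>'"]) (auto simp: bex_Un)
qed

lemma has_containers_UN:
  assumes "finite I" "\<And>i. i \<in> I \<Longrightarrow> has_containers n m (\<S> i)"
  shows "has_containers (card I * n) m (\<Union>i\<in>I. \<S> i)"
  using assms
proof (induction I rule: finite_induct)
  case empty
  show ?case by (auto simp: has_containers_def)
next
  case (insert i I)
  then have "has_containers (n + card I * n) m (\<S> i \<union> (\<Union>i\<in>I. \<S> i))"
    by (intro has_containers_Un) auto
  with insert.hyps show ?case by simp
qed

lemma has_containers_remove_set: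
  assumes "has_containers n m ((\<lambda>S. S - B) ` \<S>)" "finite B"
  shows "has_containers n (m + card B) \<S>"
proof -
  obtain \<C> where \<C>: "finite \<C>" "card \<C> \<le> n" "\<forall>C\<in>\<C>. finite C \<and> card C \<le> m"
    and cover: "\<forall>S\<in>\<S>. \<exists>C\<in>\<C>. S - B \<subseteq> C"
    using assms(1) unfolding has_containers_def by auto
  have "card (B \<union> C) \<le> m + card B" if "C \<in> \<C>" for C
    using card_Un_le[of B C] \<C>(3) that by fastforce
  moreover have "\<forall>S\<in>\<S>. \<exists>C\<in>\<C>. S \<subseteq> B \<union> C"
    using cover by (simp add: Diff_subset_conv)
  moreover have "card ((\<union>) B ` \<C>) \<le> n"
    using card_image_le[OF \<C>(1)] \<C>(2) by (rule order_trans)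
  ultimately show ?thesis
    unfolding has_containers_def using \<C> assms(2)
    by (intro exI[of _ "(\<union>) B ` \<C>"]) simp
qed

definition independent_sets :: "('b \<Rightarrow> 'b \<Rightarrow> bool) \<Rightarrow> 'b set \<Rightarrow> 'b set set" where
  "independent_sets E V = {I. I \<subseteq> V \<and> pairwise (\<lambda>x y. \<not> E x y) I}"

definition neighbours :: "('b \<Rightarrow> 'b \<Rightarrow> bool) \<Rightarrow> 'b set \<Rightarrow> 'b \<Rightarrow> 'b set" where
  "neighbours E V v = {y \<in> V. y \<noteq> v \<and> E v y}"

lemma neighbours_subset: "neighbours E V v \<subseteq> V"
  by (auto simp: neighbours_def)

lemma has_containers_independent_sets_branch:
  assumes "has_containers n m (independent_sets E (V - {v} - neighbours E V v))"
    and "has_containers n' (m + 1) (independent_sets E (V - {v}))"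
  shows "has_containers (n + n') (m + 1) (independent_sets E V)"
proof (rule has_containers_mono)
  let ?with_v = "{I \<in> independent_sets E V. v \<in> I}"
  have "(\<lambda>I. I - {v}) ` ?with_v \<subseteq> independent_sets E (V - {v} - neighbours E V v)"
    by (auto simp: independent_sets_def neighbours_def pairwise_def)
  then have "has_containers n m ((\<lambda>I. I - {v}) ` ?with_v)"
    using has_containers_mono[OF assms(1)] by simp
  then have "has_containers n (m + 1) ?with_v"
    using has_containers_remove_set[of n m "{v}"] by simp
  then show "has_containers (n + n') (m + 1) (?with_v \<union> independent_sets E (V - {v}))"
    using assms(2) by (rule has_containers_Un)
  show "independent_sets E V \<subseteq> ?with_v \<union> independent_sets E (V - {v})"
    by (auto simp: independent_sets_def)
qed auto

lemma card_Diff_neighbours_le: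
  fixes d :: real
  assumes "finite V" "d * card V \<le> card (neighbours E V v)"
  shows "card (V - {v} - neighbours E V v) \<le> (1 - d) * card V"
proof -
  have "card (V - {v} - neighbours E V v) \<le> card (V - neighbours E V v)"
    using assms(1) by (intro card_mono) auto
  also have "\<dots> = card V - card (neighbours E V v)"
    using finite_subset[OF neighbours_subset assms(1)]
    by (intro card_Diff_subset neighbours_subset)
  finally show ?thesis
    using assms(2) card_mono[OF assms(1) neighbours_subset[of E V v]]
    by (simp add: left_diff_distrib of_nat_diff)
qed

lemma has_containers_independent_sets_branch_power:
  assumes "finite V" "v \<in> V"
    and "has_containers ((card (V - {v} - neighbours E V v) + 1) ^ k) m
      (independent_sets E (V - {v} - neighbours E V v))"
    and "has_containers ((card (V - {v}) + 1) ^ Suc k) (m + 1) (independent_sets E (V - {v}))"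
  shows "has_containers ((card V + 1) ^ Suc k) (m + 1) (independent_sets E V)"
proof (rule has_containers_mono)
  let ?V1 = "V - {v} - neighbours E V v" and ?V2 = "V - {v}"
  show "has_containers ((card ?V1 + 1) ^ k + (card ?V2 + 1) ^ Suc k) (m + 1) (independent_sets E V)"
    using assms(3,4) by (rule has_containers_independent_sets_branch)
  have "card ?V1 \<le> card ?V2"
    using \<open>finite V\<close> by (intro card_mono) auto
  moreover have "card ?V2 + 1 = card V"
    using assms(1,2) card_Suc_Diff1 by fastforce
  ultimately have "(card ?V1 + 1) ^ k + (card ?V2 + 1) ^ Suc k \<le> card V ^ k + card V ^ Suc k"
    by (intro add_mono power_mono) auto
  also have "\<dots> = card V ^ k * (card V + 1)"
    by simp
  also have "\<dots> \<le> (card V + 1) ^ Suc k"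
    unfolding power_Suc2 by (intro mult_right_mono power_mono) auto
  finally show "(card ?V1 + 1) ^ k + (card ?V2 + 1) ^ Suc k \<le> (card V + 1) ^ Suc k" .
qed auto

theorem has_containers_independent_sets:
  fixes E :: "'b \<Rightarrow> 'b \<Rightarrow> bool" and d :: real and K j :: nat
  assumes "finite V"
    and "\<And>U. U \<subseteq> V \<Longrightarrow> K < card U \<Longrightarrow> \<exists>v\<in>U. d * card U \<le> card (neighbours E U v)"
    and "(1 - d) ^ j * card V \<le> K"
  shows "has_containers ((card V + 1) ^ j) (K + j) (independent_sets E V)"
  using assms
proof (induction V arbitrary: j rule: finite_psubset_induct)
  case (psubset V)
  show ?case
  proof (cases "card V \<le> K")
    case True
    show ?thesis
      by (rule has_containers_mono[OF has_containers_Pow[OF \<open>finite V\<close> True]])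
        (auto simp: independent_sets_def)
  next
    case False
    then obtain v where v: "v \<in> V" "d * card V \<le> card (neighbours E V v)"
      using psubset.prems(1)[of V] by auto
    obtain k where j: "j = Suc k"
      using False psubset.prems(2) by (cases j) auto
    let ?V1 = "V - {v} - neighbours E V v" and ?V2 = "V - {v}"
    have card_V1_le: "card ?V1 \<le> (1 - d) * card V"
      using card_Diff_neighbours_le \<open>finite V\<close> v(2) .
    then have "0 \<le> (1 - d) * card V"
      by linarith
    then have "d \<le> 1"
      using False by (simp add: zero_le_mult_iff)
    have "(1 - d) ^ k * card ?V1 \<le> (1 - d) ^ k * ((1 - d) * card V)"
      using card_V1_le \<open>d \<le> 1\<close> by (intro mult_left_mono) auto
    then have "(1 - d) ^ k * card ?V1 \<le> K"
      using psubset.prems(2) by (simp add: j mult_ac)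
    then have containers_V1: "has_containers ((card ?V1 + 1) ^ k) (K + k) (independent_sets E ?V1)"
      using psubset.IH[of ?V1 k] psubset.prems(1) v(1) by blast
    have "(1 - d) ^ j * card ?V2 \<le> (1 - d) ^ j * card V"
      using \<open>d \<le> 1\<close> \<open>finite V\<close> by (intro mult_left_mono) (auto intro: card_mono)
    then have "(1 - d) ^ j * card ?V2 \<le> K"
      using psubset.prems(2) by linarith
    then have "has_containers ((card ?V2 + 1) ^ Suc k) (K + k + 1) (independent_sets E ?V2)"
      using psubset.IH[of ?V2 j] psubset.prems(1) v(1) by (auto simp: j)
    with \<open>finite V\<close> v(1) containers_V1 show ?thesis
      using has_containers_independent_sets_branch_power[of V v E k "K + k"] by (simp add: j)
  qed
qed

section \<open>Lines and arcs in finite planes\<close>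

lemma sum_card_fibres_ge:
  fixes g :: "'b \<Rightarrow> 'c"
  assumes "finite U" "finite T" "g ` U \<subseteq> T"
  shows "(card U)\<^sup>2 / card T - card U
    \<le> real (\<Sum>x\<in>U. card (neighbours (\<lambda>x y. g x = g y) U x))"
proof -
  let ?n = "\<lambda>t. real (card {y \<in> U. g y = t})"
  have fibre: "real (card (neighbours (\<lambda>x y. g x = g y) U x)) = ?n (g x) - 1" if "x \<in> U" for x
  proof -
    have "{y \<in> U. g y = g x} = insert x (neighbours (\<lambda>x y. g x = g y) U x)"
      using that by (auto simp: neighbours_def)
    then show ?thesis
      using assms(1) by (simp add: neighbours_def)
  qed
  have sum_over_fibres: "(\<Sum>x\<in>U. h (g x)) = (\<Sum>t\<in>T. ?n t * h t)" for h :: "'c \<Rightarrow> real"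
    using assms by (rule sum_fun_comp)
  have "(card U)\<^sup>2 = (\<Sum>t\<in>T. ?n t)\<^sup>2"
    using sum_over_fibres[of "\<lambda>_. 1"] by simp
  also have "\<dots> \<le> (\<Sum>t\<in>T. (?n t)\<^sup>2) * card T"
    by (rule sum_squared_le_sum_of_squares)
  also have "(\<Sum>t\<in>T. (?n t)\<^sup>2) = (\<Sum>x\<in>U. ?n (g x))"
    using sum_over_fibres[of ?n] by (simp add: power2_eq_square)
  finally have "(card U)\<^sup>2 / card T \<le> (\<Sum>x\<in>U. ?n (g x))"
    by (cases "card T = 0") (auto simp: divide_le_eq intro: sum_nonneg)
  then show ?thesis
    by (simp add: fibre sum_subtractf)
qed

definition line_through :: "('a, 'm) ring_scheme \<Rightarrow> 'a \<times> 'a \<Rightarrow> 'a \<times> 'a \<Rightarrow> ('a \<times> 'a) set" where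
  "line_through F x y =
     line_of F (snd y \<ominus>\<^bsub>F\<^esub> snd x) (fst x \<ominus>\<^bsub>F\<^esub> fst y)
       ((snd y \<ominus>\<^bsub>F\<^esub> snd x) \<otimes>\<^bsub>F\<^esub> fst x \<oplus>\<^bsub>F\<^esub> (fst x \<ominus>\<^bsub>F\<^esub> fst y) \<otimes>\<^bsub>F\<^esub> snd x)"

definition joined_via ::
  "('a, 'm) ring_scheme \<Rightarrow> ('a \<times> 'a) set \<Rightarrow> 'a \<times> 'a \<Rightarrow> 'a \<times> 'a \<Rightarrow> bool" where
  "joined_via F B x y \<longleftrightarrow> B \<inter> line_through F x y \<noteq> {}"

text \<open>\<open>None\<close> stands for the vertical direction; its use as a junk value at \<open>x = z\<close> is harmless,
  because \<open>z\<close> lies on \<open>line_through F z y\<close> for every \<open>y\<close>.\<close>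

definition slope :: "('a, 'm) ring_scheme \<Rightarrow> 'a \<times> 'a \<Rightarrow> 'a \<times> 'a \<Rightarrow> 'a option" where
  "slope F z x = (if fst x = fst z then None
     else Some ((snd x \<ominus>\<^bsub>F\<^esub> snd z) \<otimes>\<^bsub>F\<^esub> inv\<^bsub>F\<^esub> (fst x \<ominus>\<^bsub>F\<^esub> fst z)))"

lemma arc_in_imp_subset_plane: "arc_in F A \<Longrightarrow> A \<subseteq> plane F"
  by (simp add: arc_in_def)

lemma arc_in_subset:
  assumes "arc_in F A" "B \<subseteq> A"
  shows "arc_in F B"
  using assms unfolding arc_in_def by (meson subset_iff)

lemma card_arc_Int_line_le:
  assumes "arc_in F A" "l \<in> lines F"
  shows "card (A \<inter> l) \<le> 2"
proof (rule ccontr)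
  assume "\<not> card (A \<inter> l) \<le> 2"
  then have "3 \<le> card (A \<inter> l)"
    by simp
  then obtain T where "T \<subseteq> A \<inter> l" "card T = 3"
    by (metis obtain_subset_with_card_n)
  then obtain x y z where "{x, y, z} \<subseteq> A \<inter> l" "x \<noteq> y" "y \<noteq> z" "x \<noteq> z"
    by (auto simp: card_3_iff)
  then show False
    using assms unfolding arc_in_def by blast
qed

lemma max_arc_attained:
  assumes "finite P"
  obtains A where "A \<subseteq> P" "arc_in F A" "card A = max_arc F P"
proof -
  let ?sizes = "{card A | A. A \<subseteq> P \<and> arc_in F A}"
  have "?sizes \<subseteq> card ` Pow P" by auto
  then have "finite ?sizes" using assms by (simp add: finite_subset)
  moreover have "?sizes \<noteq> {}"
    by (auto intro!: exI[of _ "{}"] simp: arc_in_def)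
  ultimately have "max_arc F P \<in> ?sizes"
    unfolding max_arc_def by (rule Max_in)
  then show thesis using that by auto
qed

context field
begin

lemma line_through_in_lines:
  assumes "x \<in> plane R" "y \<in> plane R" "x \<noteq> y"
  shows "line_through R x y \<in> lines R"
proof -
  have "\<not> (snd y \<ominus> snd x = \<zero> \<and> fst x \<ominus> fst y = \<zero>)"
    using assms by (auto simp: plane_def prod_eq_iff)
  then show ?thesis
    using assms unfolding line_through_def lines_def plane_def by fastforce
qed

lemma endpoints_in_line_through:
  assumes "x \<in> plane R" "y \<in> plane R"
  shows "x \<in> line_through R x y" "y \<in> line_through R x y"
proof -
  obtain x1 x2 y1 y2 where coordinates: "x = (x1, x2)" "y = (y1, y2)"
    by fastforce
  then have carrier: "x1 \<in> carrier R" "x2 \<in> carrier R" "y1 \<in> carrier R" "y2 \<in> carrier R"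
    using assms by (auto simp: plane_def)
  then have "(y2 \<ominus> x2) \<otimes> y1 \<oplus> (x1 \<ominus> y1) \<otimes> y2 = (y2 \<ominus> x2) \<otimes> x1 \<oplus> (x1 \<ominus> y1) \<otimes> x2"
    by algebra
  then show "x \<in> line_through R x y" "y \<in> line_through R x y"
    using assms by (auto simp: line_through_def line_of_def coordinates)
qed

lemma slope_in_carrier:
  assumes "x \<in> plane R" "z \<in> plane R" "slope R z x = Some s"
  shows "s \<in> carrier R"
  using assms by (auto simp: slope_def plane_def field_Units split: if_splits)

lemma snd_eq_slope:
  assumes "x \<in> plane R" "z \<in> plane R" "slope R z x = Some s"
  shows "snd x = s \<otimes> (fst x \<ominus> fst z) \<oplus> snd z"
proof -
  have carrier: "fst x \<in> carrier R" "snd x \<in> carrier R" "fst z \<in> carrier R" "snd z \<in> carrier R"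
    using assms by (auto simp: plane_def)
  have s: "s = (snd x \<ominus> snd z) \<otimes> inv (fst x \<ominus> fst z)" and "fst x \<noteq> fst z"
    using assms(3) by (auto simp: slope_def split: if_splits)
  then have "fst x \<ominus> fst z \<in> Units R"
    using carrier by (simp add: field_Units)
  then have "s \<otimes> (fst x \<ominus> fst z) = snd x \<ominus> snd z"
    using carrier s by (simp add: m_assoc)
  moreover have "snd x = (snd x \<ominus> snd z) \<oplus> snd z"
    using carrier by algebra
  ultimately show ?thesis by simp
qed

lemma slope_eq_imp_joined_via:
  assumes "x \<in> plane R" "y \<in> plane R" "z \<in> plane R" "slope R z x = slope R z y"
  shows "joined_via R {z} x y"
proof -
  obtain x1 x2 y1 y2 z1 z2 where coordinates: "x = (x1, x2)" "y = (y1, y2)" "z = (z1, z2)"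
    by (metis surj_pair)
  then have carrier: "x1 \<in> carrier R" "x2 \<in> carrier R" "y1 \<in> carrier R" "y2 \<in> carrier R"
    "z1 \<in> carrier R" "z2 \<in> carrier R"
    using assms(1-3) by (auto simp: plane_def)
  have "(y2 \<ominus> x2) \<otimes> z1 \<oplus> (x1 \<ominus> y1) \<otimes> z2 = (y2 \<ominus> x2) \<otimes> x1 \<oplus> (x1 \<ominus> y1) \<otimes> x2"
  proof (cases "slope R z x")
    case None
    then have "x1 = z1" "y1 = z1"
      using assms(4) by (auto simp: slope_def coordinates split: if_splits)
    moreover have "(y2 \<ominus> x2) \<otimes> z1 \<oplus> (z1 \<ominus> z1) \<otimes> z2 = (y2 \<ominus> x2) \<otimes> z1 \<oplus> (z1 \<ominus> z1) \<otimes> x2"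
      using carrier by algebra
    ultimately show ?thesis by simp
  next
    case (Some s)
    have s: "s \<in> carrier R"
      using slope_in_carrier assms(1,3) Some .
    have on_line: "x2 = s \<otimes> (x1 \<ominus> z1) \<oplus> z2" "y2 = s \<otimes> (y1 \<ominus> z1) \<oplus> z2"
      using snd_eq_slope[of x z s] snd_eq_slope[of y z s] assms Some by (auto simp: coordinates)
    show ?thesis
      unfolding on_line using carrier s by algebra
  qed
  then show ?thesis
    using assms(3) by (auto simp: joined_via_def line_through_def line_of_def coordinates)
qed

lemma arc_Diff_in_independent_sets:
  assumes A: "arc_in R A" and "B \<subseteq> A"
  shows "A - B \<in> independent_sets (joined_via R B) (plane R)"
proof -
  have plane: "A \<subseteq> plane R"
    using A by (rule arc_in_imp_subset_plane)
  have "\<not> joined_via R B x y" if "x \<in> A - B" "y \<in> A - B" "x \<noteq> y" for x y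
  proof
    assume "joined_via R B x y"
    then obtain z where z: "z \<in> B" "z \<in> line_through R x y"
      by (auto simp: joined_via_def)
    have "line_through R x y \<in> lines R"
      using that plane by (intro line_through_in_lines) auto
    moreover have "x \<in> line_through R x y" "y \<in> line_through R x y"
      using that plane by (auto intro: endpoints_in_line_through)
    moreover have "z \<in> A" "x \<noteq> z" "y \<noteq> z"
      using that z \<open>B \<subseteq> A\<close> by auto
    ultimately show False
      using A that z unfolding arc_in_def by blast
  qed
  then show ?thesis
    using plane by (auto simp: independent_sets_def pairwise_def)
qed

lemma sum_card_neighbours_via_point_le:
  assumes "arc_in R B" "finite B" "finite U" "U \<subseteq> plane R" "x \<in> U"
  shows "(\<Sum>z\<in>B. card (neighbours (joined_via R {z}) U x))
    \<le> 2 * card (neighbours (joined_via R B) U x)"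
proof -
  let ?W = "neighbours (joined_via R B) U x"
  have "(\<Sum>z\<in>B. card (neighbours (joined_via R {z}) U x))
      = (\<Sum>z\<in>B. card {y \<in> ?W. z \<in> line_through R x y})"
    by (intro sum.cong arg_cong[of _ _ card]) (auto simp: neighbours_def joined_via_def)
  also have "\<dots> = (\<Sum>y\<in>?W. card (B \<inter> line_through R x y))"
    using assms by (intro sum_multicount_gen) (auto simp: neighbours_def Int_def)
  also have "\<dots> \<le> card ?W * 2"
  proof -
    have "card (B \<inter> line_through R x y) \<le> 2" if "y \<in> ?W" for y
      by (rule card_arc_Int_line_le[OF assms(1) line_through_in_lines])
        (use that assms in \<open>auto simp: neighbours_def\<close>)
    then show ?thesis
      using sum_bounded_above[of ?W "\<lambda>y. card (B \<inter> line_through R x y)" 2] by simp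
  qed
  finally show ?thesis by simp
qed

end

section \<open>Choice of parameters\<close>

lemma two_thirds_le_ln:
  assumes "2 \<le> x"
  shows "2 / 3 \<le> ln (x :: real)"
  using ln2_ge_two_thirds ln_le_cancel_iff[of 2 x] assms by linarith

lemma one_minus_power_mult_le_one:
  fixes d y :: real
  assumes "d \<le> 1" "0 < y" "ln y \<le> d * real j"
  shows "(1 - d) ^ j * y \<le> 1"
proof -
  have "(1 - d) ^ j * y \<le> exp (- d) ^ j * exp (ln y)"
    using assms exp_minus_ge[of d] by (intro mult_mono power_mono) auto
  also have "\<dots> = exp (ln y - d * j)"
    by (simp add: exp_of_nat2_mult[symmetric] exp_add[symmetric])
  also have "\<dots> \<le> 1"
    using assms(3) by simp
  finally show ?thesis .
qed

lemma sqrt_add_ln_div_sqrt_le: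
  fixes x :: real
  assumes "2 \<le> x"
  shows "sqrt x + 8 * (x + 1) * ln x / sqrt x + 2 \<le> 16 * sqrt x * ln x"
proof -
  define s where "s = sqrt x"
  have s: "s * s = x" "6 / 5 \<le> s"
    using assms unfolding s_def by (simp, intro real_le_rsqrt) (simp add: power2_eq_square)
  have "8 * (x + 1) * ln x \<le> 12 * x * ln x"
    using assms by (intro mult_right_mono) auto
  also have "\<dots> = 12 * (s * ln x) * s"
    by (simp add: s(1)[symmetric])
  finally have "8 * (x + 1) * ln x / s \<le> 12 * (s * ln x)"
    using s(2) by (subst pos_divide_le_eq) auto
  moreover have "s * (2 / 3) \<le> s * ln x"
    using two_thirds_le_ln[OF assms] s(2) by (intro mult_left_mono) auto
  ultimately have "s + 8 * (x + 1) * ln x / s + 2 \<le> 16 * (s * ln x)"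
    using s(2) by linarith
  then show ?thesis
    by (simp only: s_def mult.assoc)
qed

lemma branching_parameters:
  fixes x :: real
  assumes "2 \<le> x"
  obtains b j :: nat where "b \<le> sqrt x + 1" "b + j \<le> 16 * sqrt x * ln x"
    "(1 - b / (4 * (x + 1))) ^ j * x\<^sup>2 \<le> 1"
proof -
  \<comment> \<open>\<open>j\<close> branchings need \<open>b * j\<close> to be about \<open>8 x ln x\<close>; \<open>b = sqrt x\<close> minimizes \<open>b + j\<close> up to
    a power of \<open>ln x\<close>.\<close>
  define b where "b = nat \<lceil>sqrt x\<rceil>"
  define j where "j = nat \<lceil>8 * (x + 1) * ln x / sqrt x\<rceil>"
  have "0 < sqrt x"
    using assms by simp
  then have b: "sqrt x \<le> b" "b \<le> sqrt x + 1"
    unfolding b_def by linarith+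
  have "0 \<le> 8 * (x + 1) * ln x / sqrt x"
    using assms by simp
  then have j: "8 * (x + 1) * ln x / sqrt x \<le> j" "j \<le> 8 * (x + 1) * ln x / sqrt x + 1"
    unfolding j_def by linarith+
  have "b + j \<le> 16 * sqrt x * ln x"
    using sqrt_add_ln_div_sqrt_le[OF assms] b(2) j(2) by linarith
  have "sqrt x \<le> x"
    using assms by (intro real_le_lsqrt) (auto simp: self_le_power)
  then have "b / (4 * (x + 1)) \<le> 1"
    using b(2) assms by (simp add: divide_le_eq)
  moreover have "ln (x\<^sup>2) \<le> b / (4 * (x + 1)) * j"
  proof -
    have "sqrt x * (8 * (x + 1) * ln x / sqrt x) \<le> b * real j"
      using b(1) j(1) assms by (intro mult_mono) auto
    then have "2 * ln x * (4 * (x + 1)) \<le> b * real j"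
      using assms by (simp add: mult_ac)
    then show ?thesis
      using assms by (simp add: ln_realpow pos_le_divide_eq)
  qed
  ultimately have "(1 - b / (4 * (x + 1))) ^ j * x\<^sup>2 \<le> 1"
    using assms by (intro one_minus_power_mult_le_one) auto
  with b(2) \<open>b + j \<le> 16 * sqrt x * ln x\<close> show thesis
    by (rule that)
qed

section \<open>Containers for arcs\<close>

locale field_of_order = field R for R (structure) and q :: nat +
  assumes finite_carrier: "finite (carrier R)" and card_carrier: "card (carrier R) = q"
begin

lemma order_ge_2: "2 \<le> q"
proof -
  have "card {\<zero>, \<one>} \<le> card (carrier R)"
    using finite_carrier by (intro card_mono) auto
  then show ?thesis by (simp add: card_carrier)
qed

lemma finite_plane: "finite (plane R)"
  by (simp add: plane_def finite_carrier)

lemma card_plane: "card (plane R) = q\<^sup>2"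
  by (simp add: plane_def card_cartesian_product card_carrier power2_eq_square)

lemma sum_card_neighbours_via_point_ge:
  assumes "U \<subseteq> plane R" "z \<in> plane R"
  shows "(card U)\<^sup>2 / (q + 1) - card U \<le> real (\<Sum>x\<in>U. card (neighbours (joined_via R {z}) U x))"
proof -
  let ?slopes = "insert None (Some ` carrier R)"
  have "finite U"
    using assms(1) finite_plane finite_subset by blast
  have "slope R z x \<in> ?slopes" if "x \<in> U" for x
    using slope_in_carrier[of x z] that assms by (cases "slope R z x") auto
  then have "(card U)\<^sup>2 / card ?slopes - card U
      \<le> real (\<Sum>x\<in>U. card (neighbours (\<lambda>x y. slope R z x = slope R z y) U x))"
    using \<open>finite U\<close> finite_carrier by (intro sum_card_fibres_ge) auto
  also have "\<dots> \<le> real (\<Sum>x\<in>U. card (neighbours (joined_via R {z}) U x))"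
  proof (intro of_nat_mono sum_mono card_mono)
    fix x assume "x \<in> U"
    then show "neighbours (\<lambda>x y. slope R z x = slope R z y) U x \<subseteq> neighbours (joined_via R {z}) U x"
      using slope_eq_imp_joined_via assms unfolding neighbours_def by blast
  qed (use \<open>finite U\<close> in \<open>auto simp: neighbours_def\<close>)
  finally show ?thesis
    by (simp add: finite_carrier card_image card_carrier card_insert_if add_ac)
qed

lemma sum_card_neighbours_via_arc_ge:
  assumes B: "arc_in R B" and U: "U \<subseteq> plane R" "2 * (q + 1) \<le> card U"
  shows "card B / (4 * (real q + 1)) * (card U)\<^sup>2
    \<le> real (\<Sum>x\<in>U. card (neighbours (joined_via R B) U x))"
proof -
  define D where "D = real q + 1"
  define u where "u = real (card U)"
  have plane: "B \<subseteq> plane R"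
    using B by (rule arc_in_imp_subset_plane)
  have finite: "finite U" "finite B"
    using U plane finite_plane finite_subset by blast+
  have "D > 0" "2 * D \<le> u"
    using U(2) by (simp_all add: D_def u_def)
  then have "2 * D * u \<le> u * u"
    by (intro mult_right_mono) auto
  then have half: "u\<^sup>2 / (2 * D) \<le> u\<^sup>2 / D - u"
    using \<open>D > 0\<close> by (simp add: field_simps power2_eq_square)
  have "2 * (card B / (4 * D) * u\<^sup>2) = (\<Sum>z\<in>B. u\<^sup>2 / (2 * D))"
    by simp
  also have "\<dots> \<le> (\<Sum>z\<in>B. real (\<Sum>x\<in>U. card (neighbours (joined_via R {z}) U x)))"
  proof (rule sum_mono)
    fix z assume "z \<in> B"
    then show "u\<^sup>2 / (2 * D) \<le> real (\<Sum>x\<in>U. card (neighbours (joined_via R {z}) U x))"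
      using sum_card_neighbours_via_point_ge[OF U(1), of z] plane half
      by (auto simp: D_def u_def add.commute)
  qed
  also have "\<dots> = real (\<Sum>x\<in>U. \<Sum>z\<in>B. card (neighbours (joined_via R {z}) U x))"
    unfolding of_nat_sum by (rule sum.swap)
  also have "\<dots> \<le> real (\<Sum>x\<in>U. 2 * card (neighbours (joined_via R B) U x))"
    using sum_card_neighbours_via_point_le[OF B] finite U(1) by (intro of_nat_mono sum_mono) auto
  finally show ?thesis
    by (simp add: sum_distrib_left[symmetric] D_def u_def)
qed

lemma exists_neighbours_via_arc_ge:
  assumes "arc_in R B" "U \<subseteq> plane R" "2 * (q + 1) \<le> card U"
  shows "\<exists>v\<in>U. card B / (4 * (real q + 1)) * card U \<le> card (neighbours (joined_via R B) U v)"
proof (rule ccontr)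
  let ?bound = "card B / (4 * (real q + 1)) * card U"
  assume "\<not> ?thesis"
  then have few: "real (card (neighbours (joined_via R B) U v)) < ?bound" if "v \<in> U" for v
    using that by (auto simp: not_le)
  have "finite U" "U \<noteq> {}"
    using assms(2,3) finite_plane finite_subset by auto
  then have "(\<Sum>v\<in>U. real (card (neighbours (joined_via R B) U v))) < (\<Sum>v\<in>U. ?bound)"
    by (intro sum_strict_mono few)
  also have "\<dots> = card B / (4 * (real q + 1)) * (card U)\<^sup>2"
    by (simp add: power2_eq_square)
  finally show False
    using sum_card_neighbours_via_arc_ge[OF assms] by simp
qed

lemma has_containers_superarcs:
  assumes B: "arc_in R B" and j: "(1 - card B / (4 * (real q + 1))) ^ j * q\<^sup>2 \<le> 2 * (q + 1)"
  shows "has_containers ((q\<^sup>2 + 1) ^ j) (2 * (q + 1) + j + card B) {A. arc_in R A \<and> B \<subseteq> A}"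
proof (rule has_containers_remove_set)
  have "has_containers ((q\<^sup>2 + 1) ^ j) (2 * (q + 1) + j)
      (independent_sets (joined_via R B) (plane R))"
    unfolding card_plane[symmetric]
  proof (rule has_containers_independent_sets[OF finite_plane])
    show "(1 - card B / (4 * (real q + 1))) ^ j * card (plane R) \<le> real (2 * (q + 1))"
      using j by (simp add: card_plane)
  qed (use exists_neighbours_via_arc_ge[OF B] in auto)
  then show "has_containers ((q\<^sup>2 + 1) ^ j) (2 * (q + 1) + j)
      ((\<lambda>A. A - B) ` {A. arc_in R A \<and> B \<subseteq> A})"
    by (rule has_containers_mono) (auto intro: arc_Diff_in_independent_sets)
  show "finite B"
    using arc_in_imp_subset_plane[OF B] finite_plane by (rule finite_subset)
qed

lemma card_arcs_of_card_le: "card {B. arc_in R B \<and> card B = b} \<le> (q\<^sup>2) ^ b"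
proof -
  have "card {B. arc_in R B \<and> card B = b} \<le> card {B. B \<subseteq> plane R \<and> card B = b}"
    using finite_plane by (intro card_mono) (simp_all add: Collect_mono_iff arc_in_imp_subset_plane)
  also have "\<dots> = q\<^sup>2 choose b"
    by (simp add: n_subsets finite_plane card_plane)
  also have "\<dots> \<le> (q\<^sup>2 choose b) * fact b"
    by simp
  also have "\<dots> \<le> (q\<^sup>2) ^ b"
    by (rule binomial_fact_pow)
  finally show ?thesis .
qed

lemma has_containers_arcs:
  assumes "(1 - b / (4 * (real q + 1))) ^ j * q\<^sup>2 \<le> 2 * (q + 1)"
  shows "has_containers ((q\<^sup>2 + 1) ^ (b + j)) (2 * (q + 1) + (b + j)) {A. arc_in R A \<and> b \<le> card A}"
proof (rule has_containers_mono)
  let ?\<B> = "{B. arc_in R B \<and> card B = b}"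
  have "?\<B> \<subseteq> Pow (plane R)"
    by (simp add: Pow_def Collect_mono_iff arc_in_imp_subset_plane)
  then have "finite ?\<B>"
    by (rule finite_subset) (simp add: finite_plane)
  then show "has_containers (card ?\<B> * (q\<^sup>2 + 1) ^ j) (2 * (q + 1) + j + b)
      (\<Union>B\<in>?\<B>. {A. arc_in R A \<and> B \<subseteq> A})"
  proof (rule has_containers_UN)
    fix B assume "B \<in> ?\<B>"
    then show "has_containers ((q\<^sup>2 + 1) ^ j) (2 * (q + 1) + j + b) {A. arc_in R A \<and> B \<subseteq> A}"
      using has_containers_superarcs[of B j] assms by simp
  qed
  have "card ?\<B> \<le> (q\<^sup>2 + 1) ^ b"
    using card_arcs_of_card_le by (rule order_trans) (simp add: power_mono)
  then show "card ?\<B> * (q\<^sup>2 + 1) ^ j \<le> (q\<^sup>2 + 1) ^ (b + j)"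
    unfolding power_add by (rule mult_right_mono) simp
  show "{A. arc_in R A \<and> b \<le> card A} \<subseteq> (\<Union>B\<in>?\<B>. {A. arc_in R A \<and> B \<subseteq> A})"
  proof
    fix A assume "A \<in> {A. arc_in R A \<and> b \<le> card A}"
    then have A: "arc_in R A" "b \<le> card A"
      by simp_all
    obtain B where B: "B \<subseteq> A" "card B = b"
      using obtain_subset_with_card_n[OF A(2)] by metis
    then have "B \<in> ?\<B>"
      using arc_in_subset[OF A(1) B(1)] by simp
    with A(1) B(1) show "A \<in> (\<Union>B\<in>?\<B>. {A. arc_in R A \<and> B \<subseteq> A})"
      by blast
  qed
qed auto

theorem has_containers_large_arcs:
  obtains k where "k \<le> 16 * sqrt q * ln q"
    "has_containers ((q\<^sup>2 + 1) ^ k) (2 * (q + 1) + k) {A. arc_in R A \<and> sqrt q + 1 \<le> card A}"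
proof -
  obtain b j where b: "real b \<le> sqrt q + 1" and k: "real b + real j \<le> 16 * sqrt q * ln q"
    and small: "(1 - b / (4 * (real q + 1))) ^ j * (real q)\<^sup>2 \<le> 1"
    using branching_parameters[of "real q"] order_ge_2 by auto
  have "has_containers ((q\<^sup>2 + 1) ^ (b + j)) (2 * (q + 1) + (b + j)) {A. arc_in R A \<and> b \<le> card A}"
    using small by (intro has_containers_arcs) simp
  moreover have "{A. arc_in R A \<and> sqrt q + 1 \<le> card A} \<subseteq> {A. arc_in R A \<and> b \<le> card A}"
    using b by auto
  ultimately have "has_containers ((q\<^sup>2 + 1) ^ (b + j)) (2 * (q + 1) + (b + j))
      {A. arc_in R A \<and> sqrt q + 1 \<le> card A}"
    by (rule has_containers_mono[OF _ order_refl order_refl])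
  with k show thesis
    by (intro that[of "b + j"]) simp_all
qed

end

section \<open>Arcs in random subsets\<close>

lemma set_random_subset: "finite A \<Longrightarrow> set_pmf (random_subset A p) \<subseteq> Pow A"
  by (auto simp: random_subset_def)

lemma expectation_power_card_random_subset_Int:
  fixes z :: real
  assumes "finite A" "0 \<le> p" "p \<le> 1" "0 \<le> z"
  shows "measure_pmf.expectation (random_subset A p) (\<lambda>Q. z ^ card (Q \<inter> C)) =
    (1 + p * (z - 1)) ^ card (A \<inter> C)"
proof -
  let ?weight = "\<lambda>x b. if x \<in> C \<and> b then z else 1"
  have "z ^ card ({x \<in> A. b x} \<inter> C) = (\<Prod>x\<in>A. ?weight x (b x))" for b
  proof -
    have "{x \<in> A. b x} \<inter> C = A \<inter> {x. x \<in> C \<and> b x}"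
      by auto
    then show ?thesis
      using assms(1) by (simp add: prod.If_cases)
  qed
  then have "measure_pmf.expectation (random_subset A p) (\<lambda>Q. z ^ card (Q \<inter> C)) =
      measure_pmf.expectation (Pi_pmf A False (\<lambda>_. bernoulli_pmf p)) (\<lambda>b. \<Prod>x\<in>A. ?weight x (b x))"
    by (simp add: random_subset_def)
  also have "\<dots> = (\<Prod>x\<in>A. measure_pmf.expectation (bernoulli_pmf p) (?weight x))"
    using assms by (intro expectation_prod_Pi_pmf integrable_measure_pmf_finite) auto
  also have "\<dots> = (\<Prod>x\<in>A. if x \<in> C then 1 + p * (z - 1) else 1)"
    using assms by (intro prod.cong) (auto simp: algebra_simps)
  also have "\<dots> = (1 + p * (z - 1)) ^ card (A \<inter> C)"
    using assms(1) by (simp add: prod.If_cases)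
  finally show ?thesis .
qed

lemma prob_card_random_subset_Int_ge_le:
  fixes z :: real
  assumes "finite A" "finite C" "0 \<le> p" "p \<le> 1" "1 < z"
  shows "measure_pmf.prob (random_subset A p) {Q. t \<le> real (card (Q \<inter> C))}
    \<le> exp (p * (z - 1) * card C) * z powr - t"
proof -
  let ?M = "random_subset A p"
  have finite_support: "finite (set_pmf ?M)"
    using set_random_subset[OF assms(1)] by (rule finite_subset) (simp add: assms(1))
  have "measure_pmf.expectation ?M (\<lambda>Q. z ^ card (Q \<inter> C)) = (1 + p * (z - 1)) ^ card (A \<inter> C)"
    using assms by (intro expectation_power_card_random_subset_Int) auto
  also have "\<dots> \<le> (1 + p * (z - 1)) ^ card C"
    using assms by (intro power_increasing card_mono) auto
  also have "\<dots> \<le> exp (p * (z - 1)) ^ card C"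
    using assms by (intro power_mono exp_ge_add_one_self) auto
  also have "\<dots> = exp (p * (z - 1) * card C)"
    by (simp add: exp_of_nat2_mult)
  finally have generating_function:
    "measure_pmf.expectation ?M (\<lambda>Q. z ^ card (Q \<inter> C)) \<le> exp (p * (z - 1) * card C)" .
  have "measure_pmf.prob ?M {Q. t \<le> real (card (Q \<inter> C))}
      = measure_pmf.prob ?M {Q \<in> space ?M. z powr t \<le> z ^ card (Q \<inter> C)}"
    using assms(5) by (simp add: powr_realpow[symmetric])
  also have "\<dots> \<le> measure_pmf.expectation ?M (\<lambda>Q. z ^ card (Q \<inter> C)) / z powr t"
    using integrable_measure_pmf_finite[OF finite_support] assms(5)
    by (intro integral_Markov_inequality_measure[where A = "{}"]) auto
  also have "\<dots> \<le> exp (p * (z - 1) * card C) / z powr t"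
    using generating_function by (rule divide_right_mono) simp
  finally show ?thesis
    by (simp add: powr_minus divide_inverse)
qed

lemma prob_random_subset_superset_le:
  assumes "has_containers n m \<S>" "finite A" "0 \<le> p" "p \<le> 1"
  shows "measure_pmf.prob (random_subset A p) {Q. \<exists>S\<in>\<S>. S \<subseteq> Q \<and> t \<le> real (card S)}
    \<le> n * (exp (p * m) * 2 powr - t)"
proof -
  let ?M = "random_subset A p" and ?large = "\<lambda>C. {Q. t \<le> real (card (Q \<inter> C))}"
  obtain \<C> where \<C>: "finite \<C>" "card \<C> \<le> n" "\<forall>C\<in>\<C>. finite C \<and> card C \<le> m"
    and cover: "\<forall>S\<in>\<S>. \<exists>C\<in>\<C>. S \<subseteq> C"
    using assms(1) unfolding has_containers_def by blast
  have "{Q. \<exists>S\<in>\<S>. S \<subseteq> Q \<and> t \<le> real (card S)} \<subseteq> (\<Union>C\<in>\<C>. ?large C)"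
  proof clarify
    fix Q S assume S: "S \<in> \<S>" "S \<subseteq> Q" "t \<le> real (card S)"
    then obtain C where C: "C \<in> \<C>" "S \<subseteq> C"
      using cover by blast
    then have "card S \<le> card (Q \<inter> C)"
      using S(2) \<C>(3) by (intro card_mono) auto
    with S(3) have "Q \<in> ?large C"
      by simp
    with C(1) show "Q \<in> (\<Union>C\<in>\<C>. ?large C)"
      by (rule UN_I)
  qed
  then have "measure_pmf.prob ?M {Q. \<exists>S\<in>\<S>. S \<subseteq> Q \<and> t \<le> real (card S)}
      \<le> measure_pmf.prob ?M (\<Union>C\<in>\<C>. ?large C)"
    by (intro measure_pmf.finite_measure_mono) auto
  also have "\<dots> \<le> (\<Sum>C\<in>\<C>. measure_pmf.prob ?M (?large C))"
    using \<C>(1) by (intro measure_UNION_le) auto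
  also have "\<dots> \<le> card \<C> * (exp (p * m) * 2 powr - t)"
  proof (rule sum_bounded_above)
    fix C assume "C \<in> \<C>"
    then have "measure_pmf.prob ?M (?large C) \<le> exp (p * card C) * 2 powr - t"
      using \<C>(3) assms(2-) prob_card_random_subset_Int_ge_le[of A C p 2 t] by auto
    also have "\<dots> \<le> exp (p * m) * 2 powr - t"
      using \<C>(3) \<open>C \<in> \<C>\<close> assms(3) by (simp add: mult_left_mono)
    finally show "measure_pmf.prob ?M (?large C) \<le> exp (p * m) * 2 powr - t" .
  qed
  also have "\<dots> \<le> n * (exp (p * m) * 2 powr - t)"
    using \<C>(2) by (intro mult_right_mono) auto
  finally show ?thesis .
qed

lemma prob_max_arc_ge_le_of_containers:
  assumes "has_containers n m {A. arc_in F A \<and> r \<le> real (card A)}" "r \<le> t"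
    and finite: "finite (plane F)" and p: "0 \<le> p" "p \<le> 1"
  shows "measure_pmf.prob (random_subset (plane F) p) {Q. t \<le> real (max_arc F Q)}
    \<le> n * (exp (p * m) * 2 powr - t)"
proof -
  let ?M = "random_subset (plane F) p" and ?arcs = "{A. arc_in F A \<and> r \<le> real (card A)}"
  have "\<exists>A\<in>?arcs. A \<subseteq> Q \<and> t \<le> real (card A)"
    if "Q \<in> set_pmf ?M" "t \<le> real (max_arc F Q)" for Q
  proof -
    have "Q \<subseteq> plane F"
      using set_random_subset[OF finite] that(1) by blast
    then obtain A where "A \<subseteq> Q" "arc_in F A" "card A = max_arc F Q"
      using max_arc_attained finite_subset[OF _ finite] by metis
    with that(2) \<open>r \<le> t\<close> show ?thesis
      by (intro bexI[of _ A]) simp_all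
  qed
  then have "AE Q in ?M. Q \<in> {Q. t \<le> real (max_arc F Q)} \<longrightarrow>
      Q \<in> {Q. \<exists>A\<in>?arcs. A \<subseteq> Q \<and> t \<le> real (card A)}"
    by (simp add: AE_measure_pmf_iff)
  then have "measure_pmf.prob ?M {Q. t \<le> real (max_arc F Q)}
      \<le> measure_pmf.prob ?M {Q. \<exists>A\<in>?arcs. A \<subseteq> Q \<and> t \<le> real (card A)}"
    by (intro measure_pmf.finite_measure_mono_AE) simp_all
  also have "\<dots> \<le> n * (exp (p * m) * 2 powr - t)"
    using assms(1) finite p by (rule prob_random_subset_superset_le)
  finally show ?thesis .
qed

lemma square_add_one_power_le_exp:
  fixes x :: real
  assumes "2 \<le> x"
  shows "(x\<^sup>2 + 1) ^ k \<le> exp (3 * real k * ln x)"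
proof -
  have "x\<^sup>2 + 1 \<le> 2 * x\<^sup>2"
    using assms one_le_power[of x 2] by simp
  also have "\<dots> \<le> x * x\<^sup>2"
    using assms by (intro mult_right_mono) auto
  finally have "(x\<^sup>2 + 1) ^ k \<le> (x ^ 3) ^ k"
    by (intro power_mono) (simp_all add: power3_eq_cube power2_eq_square)
  also have "\<dots> = exp (3 * real k * ln x)"
    using assms exp_of_nat_mult[of "3 * k" "ln x"] by (simp add: power_mult)
  finally show ?thesis .
qed

lemma union_bound_le_exp:
  fixes x p t :: real and k :: nat
  assumes x: "2 \<le> x" and k: "k \<le> 16 * sqrt x * ln x"
    and p: "48 * sqrt x * (ln x)\<^sup>2 \<le> x * p" "p \<le> 1" and t: "9 * (x * p) \<le> t"
  shows "(x\<^sup>2 + 1) ^ k * (exp (p * (2 * (x + 1) + k)) * 2 powr - t) \<le> exp (- (x * p))"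
proof -
  have "real k * 2 \<le> k * (3 * ln x)"
    using two_thirds_le_ln[OF x] by (intro mult_left_mono) auto
  moreover have "k * (3 * ln x) \<le> 16 * sqrt x * ln x * (3 * ln x)"
    using k two_thirds_le_ln[OF x] by (intro mult_right_mono) auto
  ultimately have k_bounds: "3 * real k * ln x \<le> x * p" "2 * real k \<le> x * p"
    using p(1) by (simp_all add: power2_eq_square)
  then have "0 \<le> x * p"
    by linarith
  then have "0 \<le> p"
    using x by (simp add: zero_le_mult_iff)
  have "(x\<^sup>2 + 1) ^ k * (exp (p * (2 * (x + 1) + k)) * 2 powr - t)
      \<le> exp (x * p) * (exp (4 * (x * p)) * exp (- 6 * (x * p)))"
  proof (intro mult_mono)
    show "(x\<^sup>2 + 1) ^ k \<le> exp (x * p)"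
      using square_add_one_power_le_exp[OF x, of k] k_bounds(1) by (meson exp_le_cancel_iff order_trans)
    have "x * p \<le> x"
      using p(2) x by (simp add: mult_left_le)
    with k_bounds(2) have "2 * real k \<le> x"
      by (rule order_trans)
    then have "2 * (x + 1) + k \<le> 4 * x"
      using x by simp
    then have "p * (2 * (x + 1) + k) \<le> p * (4 * x)"
      using \<open>0 \<le> p\<close> by (rule mult_left_mono)
    then show "exp (p * (2 * (x + 1) + k)) \<le> exp (4 * (x * p))"
      by (simp add: mult_ac)
    have "9 * (x * p) * (2 / 3) \<le> t * ln 2"
      using t ln2_ge_two_thirds \<open>0 \<le> x * p\<close> by (intro mult_mono) auto
    then show "2 powr - t \<le> exp (- 6 * (x * p))"
      by (simp add: powr_def mult_ac)
  qed auto
  also have "\<dots> = exp (- (x * p))"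
    unfolding exp_add[symmetric] by simp
  finally show ?thesis .
qed

theorem (in field_of_order) prob_max_arc_ge_le_exp:
  fixes p t :: real
  assumes p: "48 * sqrt q * (ln q)\<^sup>2 \<le> q * p" "p \<le> 1" and t: "9 * (q * p) \<le> t"
  shows "measure_pmf.prob (random_subset (plane R) p) {Q. t \<le> real (max_arc R Q)}
    \<le> exp (- (q * p))"
proof -
  have q: "2 \<le> real q"
    using order_ge_2 by simp
  have "4 / 9 \<le> (ln q)\<^sup>2"
    using power_mono[OF two_thirds_le_ln[OF q], of 2] by (simp add: power2_eq_square)
  then have "48 * sqrt q * (4 / 9) \<le> 48 * sqrt q * (ln q)\<^sup>2"
    by (intro mult_left_mono) auto
  moreover have "1 \<le> sqrt q"
    using q by simp
  ultimately have "0 \<le> q * p" "sqrt q + 1 \<le> t"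
    using p(1) t by linarith+
  then have "0 \<le> p"
    using q by (simp add: zero_le_mult_iff)
  obtain k where k: "k \<le> 16 * sqrt q * ln q"
    and containers: "has_containers ((q\<^sup>2 + 1) ^ k) (2 * (q + 1) + k)
      {A. arc_in R A \<and> sqrt q + 1 \<le> real (card A)}"
    using has_containers_large_arcs .
  have "measure_pmf.prob (random_subset (plane R) p) {Q. t \<le> real (max_arc R Q)}
      \<le> real ((q\<^sup>2 + 1) ^ k) * (exp (p * real (2 * (q + 1) + k)) * 2 powr - t)"
    using containers \<open>sqrt q + 1 \<le> t\<close> finite_plane \<open>0 \<le> p\<close> p(2)
    by (rule prob_max_arc_ge_le_of_containers)
  also have "\<dots> \<le> exp (- (q * p))"
    using union_bound_le_exp[OF q k p t] by (simp add: add_ac)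
  finally show ?thesis .
qed

theorem tendsto_prob_max_arc_ge:
  fixes F :: "nat \<Rightarrow> ('a, 'm) ring_scheme" and p t :: "nat \<Rightarrow> real"
  assumes "\<F> \<le> sequentially" "\<forall>\<^sub>F q in \<F>. field_of_order (F q) q"
    and "\<forall>\<^sub>F q in \<F>. 48 * sqrt q * (ln q)\<^sup>2 \<le> q * p q" "\<forall>\<^sub>F q in \<F>. p q \<le> 1"
    and "\<forall>\<^sub>F q in \<F>. 9 * (q * p q) \<le> t q"
  shows "((\<lambda>q. measure_pmf.prob (random_subset (plane (F q)) (p q))
    {Q. t q \<le> real (max_arc (F q) Q)}) \<longlongrightarrow> 0) \<F>"
proof (rule tendsto_sandwich[OF _ _ tendsto_const])
  have "((\<lambda>q::nat. exp (- (48 * sqrt q * (ln q)\<^sup>2))) \<longlongrightarrow> 0) sequentially"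
    by real_asymp
  then show "((\<lambda>q. exp (- (48 * sqrt q * (ln q)\<^sup>2))) \<longlongrightarrow> 0) \<F>"
    using assms(1) tendsto_mono by blast
  show "\<forall>\<^sub>F q in \<F>. measure_pmf.prob (random_subset (plane (F q)) (p q))
      {Q. t q \<le> real (max_arc (F q) Q)} \<le> exp (- (48 * sqrt q * (ln q)\<^sup>2))"
    using assms(2-)
  proof eventually_elim
    case (elim q)
    then have "measure_pmf.prob (random_subset (plane (F q)) (p q))
        {Q. t q \<le> real (max_arc (F q) Q)} \<le> exp (- (q * p q))"
      by (intro field_of_order.prob_max_arc_ge_le_exp)
    also have "\<dots> \<le> exp (- (48 * sqrt q * (ln q)\<^sup>2))"
      using elim(2) by simp
    finally show ?case .
  qed
qed auto

theorem theorem6: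
  fixes F :: "nat \<Rightarrow> 'a ring" and a :: real and f :: "real \<Rightarrow> real"
  assumes "\<And>q. primepow q \<Longrightarrow> field (F q) \<and> finite (carrier (F q)) \<and> card (carrier (F q)) = q"
    and "- 1 / 3 < a" and "a < 0"
    and "filterlim f at_top at_top"
  shows "((\<lambda>q. measure_pmf.prob (random_subset (plane (F q)) (real q powr a))
             {Q. real (max_arc (F q) Q) \<ge> real q * real q powr a * f (real q)})
           \<longlongrightarrow> 0) (inf at_top (principal {q. primepow q}))"
proof (rule tendsto_prob_max_arc_ge)
  let ?primepows = "inf sequentially (principal {q. primepow q})"
  show primepows_le: "?primepows \<le> sequentially"
    by simp
  show "\<forall>\<^sub>F q in ?primepows. field_of_order (F q) q"
    using assms(1)
    by (simp add: eventually_inf_principal field_of_order_def field_of_order_axioms_def)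
  have "\<forall>\<^sub>F q in sequentially. 48 * sqrt q * (ln q)\<^sup>2 \<le> real q * real q powr a"
    using assms(2) by real_asymp
  then show "\<forall>\<^sub>F q in ?primepows. 48 * sqrt q * (ln q)\<^sup>2 \<le> real q * real q powr a"
    by (rule filter_leD[OF primepows_le])
  have "\<forall>\<^sub>F q in sequentially. real q powr a \<le> 1"
    using assms(3) by real_asymp
  then show "\<forall>\<^sub>F q in ?primepows. real q powr a \<le> 1"
    by (rule filter_leD[OF primepows_le])
  have "\<forall>\<^sub>F q in sequentially. 9 \<le> f (real q)"
    using filterlim_compose[OF assms(4) filterlim_real_sequentially]
    by (simp add: filterlim_at_top)
  then have "\<forall>\<^sub>F q in sequentially. 9 * (real q * real q powr a) \<le> real q * real q powr a * f q"
    by eventually_elim (subst mult.commute[of _ "f _"], rule mult_right_mono, simp_all)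
  then show "\<forall>\<^sub>F q in ?primepows. 9 * (real q * real q powr a) \<le> real q * real q powr a * f q"
    by (rule filter_leD[OF primepows_le])
qed

end
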